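(* Let $(a_{n,k})_{n,k\ge 1}$ and $(b_n)_{n\ge 1}$ be non-negative (real), let $(c_k)_{k\ge 1}$ be a sequence of positive reals, and suppose that for every fixed $n\ge 1$ the quantity $a_{n,k}/c_k$ is increasing (i.e. non-decreasing) in $k$. Let $K>0$ be a constant. (i) If $p\ge 1$ and $0<q\le p$, then the inequality $$\left(\sum_{n=1}^{\infty}\left(\sum_{k=n}^{\infty}b_nc_kx_k\right)^p\right)^{1/p}\le K\left(\sum_{n=1}^{\infty}\left(\sum_{k=1}^{\infty}a_{n,k}x_k\right)^q\right)^{1/q}$$ holds for all non-negative sequences $\mathbf{x}=(x_k)_{k\ge1}$ if and only if it holds for $\mathbf{x}=e^{(m)}$ for every $m=1,2,\ldots$. (ii) If $0<p\le 1$ and $q\ge p$, then the reversed inequality $$\left(\sum_{n=1}^{\infty}\left(\sum_{k=n}^{\infty}b_nc_kx_k\right)^p\right)^{1/p}\ge K\left(\sum_{n=1}^{\infty}\left(\sum_{k=1}^{\infty}a_{n,k}x_k\right)^q\right)^{1/q}$$ holds for all non-negative sequences $\mathbf{x}=(x_k)_{k\ge1}$ if and only if it holds for $\mathbf{x}=e^{(m)}$ for every $m=1,2,\ldots$.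
   Context: The exponents $p,q$ are fixed finite positive reals. $e^{(m)}$ denotes the sequence whose $m$-th entry is $1$ and whose other entries are $0$. The constant $K$ may depend on $p,q$ (and on the given matrix and sequences) but not on $\mathbf{x}$. All sums of non-negative terms are understood as elements of $[0,\infty]$, with the conventions $0\cdot\infty=0$ and $\infty^t=\infty$ for $t>0$. *)

theory Defs
  imports "HOL-Analysis.Analysis"
begin

text \<open>
  Powers with positive real exponent on \<open>[0,\<infinity>]\<close>. For \<open>t > 0\<close> this gives
  \<open>0 powr t = 0\<close> and \<open>\<infinity> powr t = \<infinity>\<close>; exponents \<open>t \<le> 0\<close> are never used.
\<close>

definition ennreal_powr :: "ennreal \<Rightarrow> real \<Rightarrow> ennreal" where
  "ennreal_powr y t = (if y = \<infinity> then \<infinity> else ennreal (enn2real y powr t))"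

text \<open>
  Sequences are functions on \<open>nat\<close> of which only the entries with index at least 1 matter.
  Every \<open>ennreal\<close>-valued family is summable in the sense of \<open>infsum\<close>, so \<open>infsum\<close> below
  is the sum in \<open>[0,\<infinity>]\<close>. For \<open>0 < r < 1\<close>, \<open>lp_sum r\<close> is only a quasi-norm.
\<close>

definition lp_sum :: "real \<Rightarrow> (nat \<Rightarrow> ennreal) \<Rightarrow> ennreal" where
  "lp_sum r y = ennreal_powr (\<Sum>\<^sub>\<infinity>n\<in>{1..}. ennreal_powr (y n) r) (1 / r)"

definition unit_seq :: "nat \<Rightarrow> nat \<Rightarrow> real" where
  "unit_seq m k = (if k = m then 1 else 0)"

text \<open>
  The function \<open>ennreal\<close> truncates negative reals to 0; it is only applied to
  non-negative terms.
\<close>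

definition tail_side :: "real \<Rightarrow> (nat \<Rightarrow> real) \<Rightarrow> (nat \<Rightarrow> real) \<Rightarrow> (nat \<Rightarrow> real) \<Rightarrow> ennreal" where
  "tail_side p b c x = lp_sum p (\<lambda>n. \<Sum>\<^sub>\<infinity>k\<in>{n..}. ennreal (b n * c k * x k))"

definition matrix_side :: "real \<Rightarrow> (nat \<Rightarrow> nat \<Rightarrow> real) \<Rightarrow> (nat \<Rightarrow> real) \<Rightarrow> ennreal" where
  "matrix_side q a x = lp_sum q (\<lambda>n. \<Sum>\<^sub>\<infinity>k\<in>{1..}. ennreal (a n k * x k))"

end

theory Submission
  imports Defs
begin

text \<open>
  For a finitely supported \<open>x\<close>, summation by parts writes the \<open>p\<close>-th power of the left-hand side as
  a non-negative combination of the \<open>p\<close>-th powers of its values at the unit sequences. The hypothesis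
  bounds each of these by the right-hand side at the same unit sequence. For \<open>p \<ge> 1 \<ge> q / p\<close> the
  combination of the right-hand sides is recombined by the reverse Minkowski inequality with
  exponent \<open>q / p\<close> and, row by row, by the inequality
  \<open>\<Sum>m. \<alpha> m powr p * (Y m powr p - Y (m + 1) powr p) \<le> (\<Sum>k. \<alpha> k * y k) powr p\<close>
  for increasing \<open>\<alpha>\<close>, where \<open>Y\<close> denotes the tail sums of \<open>y\<close>. For \<open>p \<le> 1 \<le> q / p\<close> both reverse.
  General \<open>x\<close> follow by monotone convergence.
\<close>

section \<open>Powers and sums in \<open>[0,\<infinity>]\<close>\<close>

lemma ennreal_powr_top [simp]: "ennreal_powr top t = top"
  by (simp add: ennreal_powr_def)

lemma ennreal_powr_ennreal: "0 \<le> x \<Longrightarrow> ennreal_powr (ennreal x) t = ennreal (x powr t)"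
  by (simp add: ennreal_powr_def)

lemma ennreal_powr_0 [simp]: "ennreal_powr 0 t = 0"
  by (simp add: ennreal_powr_def)

lemma ennreal_powr_one_left [simp]: "ennreal_powr 1 t = 1"
  by (simp add: ennreal_powr_def)

lemma ennreal_powr_one_right [simp]: "ennreal_powr y 1 = y"
  by (cases y) (auto simp: ennreal_powr_ennreal)

lemma ennreal_powr_powr: "ennreal_powr (ennreal_powr y s) t = ennreal_powr y (s * t)"
  by (cases y) (auto simp: ennreal_powr_ennreal powr_powr)

lemma ennreal_powr_eq_0_iff [simp]: "ennreal_powr y t = 0 \<longleftrightarrow> y = 0"
  by (cases y) (auto simp: ennreal_powr_ennreal ennreal_eq_0_iff)

lemma ennreal_powr_mult:
  "ennreal_powr (x * y) t = ennreal_powr x t * ennreal_powr y t"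
\<comment> \<open>Since \<open>0 * top = 0\<close>, a zero factor must be split off. With both
  factors non-zero, an infinite one makes both sides infinite.\<close>
proof (cases "x = 0 \<or> y = 0")
  case False
  then show ?thesis
    by (cases x; cases y)
      (auto simp: ennreal_powr_ennreal ennreal_mult_top ennreal_top_mult powr_mult
        ennreal_eq_0_iff simp flip: ennreal_mult)
qed auto

lemma ennreal_powr_mono: "x \<le> y \<Longrightarrow> 0 \<le> t \<Longrightarrow> ennreal_powr x t \<le> ennreal_powr y t"
  by (cases x; cases y) (auto simp: ennreal_powr_ennreal top_unique intro!: ennreal_leI powr_mono2)

lemma ennreal_powr_inverse:
  "t \<noteq> 0 \<Longrightarrow> ennreal_powr (ennreal_powr y t) (1 / t) = y"
  "t \<noteq> 0 \<Longrightarrow> ennreal_powr (ennreal_powr y (1 / t)) t = y"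
  by (simp_all add: ennreal_powr_powr)

lemma ennreal_powr_le_iff:
  assumes "t > 0"
  shows "ennreal_powr x t \<le> ennreal_powr y t \<longleftrightarrow> x \<le> y"
proof
  assume "ennreal_powr x t \<le> ennreal_powr y t"
  from ennreal_powr_mono[OF this, of "1 / t"] show "x \<le> y"
    using assms by (simp add: ennreal_powr_inverse)
qed (use assms in \<open>auto intro: ennreal_powr_mono\<close>)

text \<open>For \<open>t > 0\<close> the power is an order isomorphism with inverse the power
  \<open>1 / t\<close>, and order isomorphisms preserve suprema.\<close>

lemma ennreal_powr_SUP:
  assumes "t > 0"
  shows "ennreal_powr (SUP i\<in>I. X i) t = (SUP i\<in>I. ennreal_powr (X i) t)"
proof (rule antisym)
  have "X i \<le> ennreal_powr (SUP i\<in>I. ennreal_powr (X i) t) (1 / t)" if "i \<in> I" for i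
    using ennreal_powr_mono[OF SUP_upper[OF that, of "\<lambda>i. ennreal_powr (X i) t"], of "1 / t"] assms
    by (simp add: ennreal_powr_inverse)
  then have "(SUP i\<in>I. X i) \<le> ennreal_powr (SUP i\<in>I. ennreal_powr (X i) t) (1 / t)"
    by (rule SUP_least)
  from ennreal_powr_mono[OF this, of t]
  show "ennreal_powr (SUP i\<in>I. X i) t \<le> (SUP i\<in>I. ennreal_powr (X i) t)"
    using assms by (simp add: ennreal_powr_inverse)
qed (use assms in \<open>auto intro!: SUP_least ennreal_powr_mono SUP_upper\<close>)

section \<open>Unconditional sums in the extended non-negative reals\<close>

lemma ennreal_summable_on: "(f :: 'a \<Rightarrow> ennreal) summable_on A"
  by (rule nonneg_summable_on_complete) simp

lemma infsum_ennreal_mono: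
  fixes f g :: "'a \<Rightarrow> ennreal"
  shows "(\<And>x. x \<in> A \<Longrightarrow> f x \<le> g x) \<Longrightarrow> infsum f A \<le> infsum g A"
  by (intro infsum_mono ennreal_summable_on)

lemma infsum_ennreal_cmult:
  fixes f :: "'a \<Rightarrow> ennreal"
  shows "(\<Sum>\<^sub>\<infinity>x\<in>A. c * f x) = c * infsum f A"
  by (subst (1 2) nonneg_infsum_complete)
    (auto simp flip: sum_distrib_left intro!: SUP_mult_left_ennreal[symmetric])

text \<open>Monotone convergence: an infinite sum is the supremum of its finite partial sums, finite
  sums commute with suprema of increasing sequences, and two suprema can be exchanged.\<close>

lemma infsum_ennreal_SUP:
  fixes f :: "nat \<Rightarrow> 'a \<Rightarrow> ennreal"
  assumes "\<And>x. x \<in> A \<Longrightarrow> incseq (\<lambda>i. f i x)"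
  shows "(\<Sum>\<^sub>\<infinity>x\<in>A. SUP i. f i x) = (SUP i. \<Sum>\<^sub>\<infinity>x\<in>A. f i x)"
proof -
  have "(\<Sum>\<^sub>\<infinity>x\<in>A. SUP i. f i x) = (SUP F\<in>{F. finite F \<and> F \<subseteq> A}. \<Sum>x\<in>F. SUP i. f i x)"
    by (rule nonneg_infsum_complete) simp
  also have "\<dots> = (SUP F\<in>{F. finite F \<and> F \<subseteq> A}. SUP i. \<Sum>x\<in>F. f i x)"
    using assms by (intro SUP_cong refl ennreal_SUP_sum[symmetric]) auto
  also have "\<dots> = (SUP i. SUP F\<in>{F. finite F \<and> F \<subseteq> A}. \<Sum>x\<in>F. f i x)"
    by (rule SUP_commute)
  also have "\<dots> = (SUP i. \<Sum>\<^sub>\<infinity>x\<in>A. f i x)"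
    by (simp add: nonneg_infsum_complete)
  finally show ?thesis .
qed

lemma infsum_eq_sum_superset:
  fixes f :: "'a \<Rightarrow> 'b::{comm_monoid_add, t2_space}"
  assumes "finite B" "\<And>x. x \<in> A - B \<Longrightarrow> f x = 0"
  shows "infsum f A = sum f (A \<inter> B)"
proof -
  have "infsum f A = infsum f (A \<inter> B)"
    using assms(2) by (intro infsum_cong_neutral) auto
  then show ?thesis
    using assms(1) by simp
qed

section \<open>Minkowski's inequality\<close>

lemma lp_sum_powr: "r \<noteq> 0 \<Longrightarrow> ennreal_powr (lp_sum r f) r = (\<Sum>\<^sub>\<infinity>n\<in>{1..}. ennreal_powr (f n) r)"
  by (simp add: lp_sum_def ennreal_powr_inverse)

lemma lp_sum_mono:
  assumes "r > 0" "\<And>n. n \<ge> 1 \<Longrightarrow> f n \<le> g n"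
  shows "lp_sum r f \<le> lp_sum r g"
  unfolding lp_sum_def using assms
  by (intro ennreal_powr_mono infsum_ennreal_mono) auto

lemma lp_sum_cong: "(\<And>n. n \<ge> 1 \<Longrightarrow> f n = g n) \<Longrightarrow> lp_sum r f = lp_sum r g"
  unfolding lp_sum_def by (intro arg_cong[where f = "\<lambda>y. ennreal_powr y (1 / r)"] infsum_cong) auto

lemma lp_sum_zero [simp]: "lp_sum r (\<lambda>n. 0) = 0"
  by (simp add: lp_sum_def)

lemma lp_sum_cmult: "r \<noteq> 0 \<Longrightarrow> lp_sum r (\<lambda>n. c * f n) = c * lp_sum r f"
  by (simp add: lp_sum_def ennreal_powr_mult infsum_ennreal_cmult ennreal_powr_inverse)

text \<open>This trades the exponent \<open>q\<close> for \<open>q / p\<close>, so that the order of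
  \<open>p\<close> and \<open>q\<close> decides which Minkowski inequality applies.\<close>

lemma lp_sum_of_powr:
  "p \<noteq> 0 \<Longrightarrow> ennreal_powr (lp_sum q f) p = lp_sum (q / p) (\<lambda>n. ennreal_powr (f n) p)"
  by (simp add: lp_sum_def ennreal_powr_powr field_simps)

lemma lp_sum_SUP:
  assumes "r > 0" "\<And>n. n \<ge> 1 \<Longrightarrow> incseq (\<lambda>i. f i n)"
  shows "lp_sum r (\<lambda>n. SUP i. f i n) = (SUP i. lp_sum r (f i))"
proof -
  have "(\<Sum>\<^sub>\<infinity>n\<in>{1..}. SUP i. ennreal_powr (f i n) r) = (SUP i. \<Sum>\<^sub>\<infinity>n\<in>{1..}. ennreal_powr (f i n) r)"
    using assms by (intro infsum_ennreal_SUP) (auto simp: incseq_def intro: ennreal_powr_mono)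
  then show ?thesis
    using assms(1) by (simp add: lp_sum_def ennreal_powr_SUP)
qed

section \<open>Convexity and concavity of the power function\<close>

lemma powr_convex_combination:
  fixes s t x y :: real
  assumes "p \<ge> 1" "0 \<le> s" "0 \<le> t" "s + t = 1" "0 \<le> x" "0 \<le> y"
  shows "(s * x + t * y) powr p \<le> s * x powr p + t * y powr p"
proof -
  \<comment> \<open>This covers combinations with a zero argument; the convexity of
    \<open>powr\<close> is applied below to strictly positive arguments only.\<close>
  have *: "(s * x) powr p \<le> s * x powr p" if "0 \<le> s" "s \<le> 1" "0 \<le> x" for s x :: real
  proof -
    have "s powr p \<le> s"
      using powr_mono'[of 1 p s] that assms(1) by simp
    then show ?thesis
      using that by (simp add: powr_mult mult_right_mono)
  qed
  show ?thesis
  proof (cases "x = 0 \<or> y = 0")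
    case True
    then show ?thesis
      using *[of s x] *[of t y] assms by auto
  next
    case False
    have s: "s = 1 - t"
      using assms(4) by simp
    show ?thesis
      unfolding s using convex_onD[OF powr_convex[OF assms(1)], of t x y] False assms by simp
  qed
qed

lemma ennreal_powr_convex_combination:
  assumes "p \<ge> 1" "0 < s" "0 < t" "s + t = 1"
  shows "ennreal_powr (ennreal s * x + ennreal t * y) p
           \<le> ennreal s * ennreal_powr x p + ennreal t * ennreal_powr y p"
\<comment> \<open>Both weights are strictly positive, so an infinite argument makes the right-hand
  side infinite.\<close>
proof (cases "x = top \<or> y = top")
  case False
  then obtain u v where "x = ennreal u" "y = ennreal v" "0 \<le> u" "0 \<le> v"
    by (metis ennreal_cases)
  then show ?thesis
    using assms powr_convex_combination[of p s t u v]
    by (simp add: ennreal_powr_ennreal flip: ennreal_mult ennreal_plus)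
qed (use assms in \<open>auto simp: ennreal_mult_top\<close>)

text \<open>Concavity is convexity for the inverse exponent \<open>1 / r >= 1\<close>, applied to
  the \<open>r\<close>-th powers and then raised to the power \<open>r\<close>.\<close>

lemma ennreal_powr_concave_combination:
  assumes "0 < r" "r \<le> 1" "0 < s" "0 < t" "s + t = 1"
  shows "ennreal s * ennreal_powr x r + ennreal t * ennreal_powr y r
           \<le> ennreal_powr (ennreal s * x + ennreal t * y) r"
  using ennreal_powr_mono[OF ennreal_powr_convex_combination
      [of "1 / r" s t "ennreal_powr x r" "ennreal_powr y r"], of r] assms
  by (simp add: ennreal_powr_inverse)

lemma lp_sum_normalize:
  assumes "r > 0" "lp_sum r u = ennreal U" "U > 0"
  shows "\<exists>u'. (\<forall>n. u n = ennreal U * u' n) \<and> (\<Sum>\<^sub>\<infinity>n\<in>{1..}. ennreal_powr (u' n) r) = 1"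
proof (intro exI conjI allI)
  let ?u = "\<lambda>n. ennreal (1 / U) * u n"
  have "ennreal U * ennreal (1 / U) = 1"
    using assms(3) by (simp flip: ennreal_mult)
  then show "u n = ennreal U * ?u n" for n
    by (simp flip: mult.assoc)
  have "lp_sum r ?u = 1"
    using assms by (simp add: lp_sum_cmult flip: ennreal_mult)
  then show "(\<Sum>\<^sub>\<infinity>n\<in>{1..}. ennreal_powr (?u n) r) = 1"
    using assms(1) lp_sum_powr[of r ?u] by simp
qed

text \<open>
  Both Minkowski inequalities come from writing \<open>u + v\<close> as \<open>S = U + V\<close> times a convex combination
  of sequences of norm 1, to which convexity or concavity of the power is applied termwise.
\<close>

lemma lp_sum_add_normalize:
  assumes "r > 0" "lp_sum r u = ennreal U" "U > 0" "lp_sum r v = ennreal V" "V > 0"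
  obtains s t :: real and u' v' :: "nat \<Rightarrow> ennreal" where "0 < s" "0 < t" "s + t = 1"
    "lp_sum r (\<lambda>n. u n + v n) = (lp_sum r u + lp_sum r v) *
      ennreal_powr (\<Sum>\<^sub>\<infinity>n\<in>{1..}. ennreal_powr (ennreal s * u' n + ennreal t * v' n) r) (1 / r)"
    "(\<Sum>\<^sub>\<infinity>n\<in>{1..}. ennreal s * ennreal_powr (u' n) r + ennreal t * ennreal_powr (v' n) r) = 1"
proof -
  obtain u' where u': "\<And>n. u n = ennreal U * u' n" "(\<Sum>\<^sub>\<infinity>n\<in>{1..}. ennreal_powr (u' n) r) = 1"
    using lp_sum_normalize[OF assms(1,2,3)] by blast
  obtain v' where v': "\<And>n. v n = ennreal V * v' n" "(\<Sum>\<^sub>\<infinity>n\<in>{1..}. ennreal_powr (v' n) r) = 1"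
    using lp_sum_normalize[OF assms(1,4,5)] by blast
  define s t where "s = U / (U + V)" and "t = V / (U + V)"
  have st: "0 < s" "0 < t" "s + t = 1"
    using assms(3,5) by (auto simp: s_def t_def simp flip: add_divide_distrib)
  have "U = (U + V) * s" "V = (U + V) * t"
    using assms(3,5) by (auto simp: s_def t_def)
  then have UV: "ennreal U = ennreal (U + V) * ennreal s" "ennreal V = ennreal (U + V) * ennreal t"
    using assms(3,5) st by (metis add_pos_pos ennreal_mult less_imp_le)+
  have "lp_sum r (\<lambda>n. u n + v n)
      = lp_sum r (\<lambda>n. ennreal (U + V) * (ennreal s * u' n + ennreal t * v' n))"
    unfolding u'(1) v'(1) by (subst UV(1), subst UV(2)) (simp add: distrib_left mult.assoc)
  also have "\<dots> = (lp_sum r u + lp_sum r v) * lp_sum r (\<lambda>n. ennreal s * u' n + ennreal t * v' n)"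
    using assms by (simp add: lp_sum_cmult)
  finally have 1: "lp_sum r (\<lambda>n. u n + v n) = \<dots>" .
  have 2: "(\<Sum>\<^sub>\<infinity>n\<in>{1..}. ennreal s * ennreal_powr (u' n) r + ennreal t * ennreal_powr (v' n) r) = 1"
    using st u'(2) v'(2) 
    by (simp add: infsum_add ennreal_summable_on infsum_ennreal_cmult flip: ennreal_plus)
  show ?thesis
    using that[OF st, of u' v'] 1 2 by (simp add: lp_sum_def)
qed

lemma lp_sum_eq_0_imp:
  assumes "r > 0" "lp_sum r f = 0" "n \<ge> 1"
  shows "f n = 0"
proof -
  have "(\<Sum>\<^sub>\<infinity>n\<in>{1..}. ennreal_powr (f n) r) = 0"
    using lp_sum_powr[of r f] assms by simp
  moreover have "(\<Sum>\<^sub>\<infinity>n\<in>{n}. ennreal_powr (f n) r) \<le> (\<Sum>\<^sub>\<infinity>n\<in>{1..}. ennreal_powr (f n) r)"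
    using assms(3) by (intro infsum_mono_neutral ennreal_summable_on) auto
  ultimately show ?thesis by simp
qed

lemma lp_sum_triangle:
  assumes "r \<ge> 1"
  shows "lp_sum r (\<lambda>n. u n + v n) \<le> lp_sum r u + lp_sum r v"
proof -
  \<comment> \<open>Normalization needs both norms positive and finite. A sequence of norm zero
    vanishes entrywise and drops out of the sum; an infinite norm makes the bound trivial.\<close>
  consider "lp_sum r u = 0" | "lp_sum r v = 0" | "lp_sum r u = top \<or> lp_sum r v = top"
    | U V where "lp_sum r u = ennreal U" "U > 0" "lp_sum r v = ennreal V" "V > 0"
    by (cases "lp_sum r u"; cases "lp_sum r v") (auto simp: less_le)
  then show ?thesis
  proof cases
    case 1
    then have "lp_sum r (\<lambda>n. u n + v n) = lp_sum r v"
      using lp_sum_eq_0_imp[of r u] assms by (intro lp_sum_cong) auto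
    then show ?thesis by simp
  next
    case 2
    then have "lp_sum r (\<lambda>n. u n + v n) = lp_sum r u"
      using lp_sum_eq_0_imp[of r v] assms by (intro lp_sum_cong) auto
    then show ?thesis by simp
  next
    case 4
    have "r > 0" using assms by simp
    from lp_sum_add_normalize[OF this 4] obtain s t :: real and u' v' :: "nat \<Rightarrow> ennreal"
      where st: "0 < s" "0 < t" "s + t = 1"
      and eq: "lp_sum r (\<lambda>n. u n + v n) = (lp_sum r u + lp_sum r v) *
      ennreal_powr (\<Sum>\<^sub>\<infinity>n\<in>{1..}. ennreal_powr (ennreal s * u' n + ennreal t * v' n) r) (1 / r)"
      and one: "(\<Sum>\<^sub>\<infinity>n\<in>{1..}. ennreal s * ennreal_powr (u' n) r + ennreal t * ennreal_powr (v' n) r) = 1"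
      by blast
    have "(\<Sum>\<^sub>\<infinity>n\<in>{1..}. ennreal_powr (ennreal s * u' n + ennreal t * v' n) r) \<le> 1"
      unfolding one[symmetric]
      by (intro infsum_ennreal_mono ennreal_powr_convex_combination) (use assms st in auto)
    from ennreal_powr_mono[OF this, of "1 / r"] show ?thesis
      unfolding eq using assms mult_left_mono[of _ 1 "lp_sum r u + lp_sum r v"] by simp
  qed auto
qed

lemma lp_sum_reverse_triangle:
  assumes "0 < r" "r \<le> 1"
  shows "lp_sum r u + lp_sum r v \<le> lp_sum r (\<lambda>n. u n + v n)"
proof -
  \<comment> \<open>These two bounds settle the degenerate cases, where one of the norms is zero or
    infinite.\<close>
  have mono: "lp_sum r u \<le> lp_sum r (\<lambda>n. u n + v n)" "lp_sum r v \<le> lp_sum r (\<lambda>n. u n + v n)"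
    using assms by (auto intro!: lp_sum_mono)
  consider "lp_sum r u = 0 \<or> lp_sum r v = 0 \<or> lp_sum r u = top \<or> lp_sum r v = top"
    | U V where "lp_sum r u = ennreal U" "U > 0" "lp_sum r v = ennreal V" "V > 0"
    by (cases "lp_sum r u"; cases "lp_sum r v") (auto simp: less_le)
  then show ?thesis
  proof cases
    case 1
    then show ?thesis using mono by (auto simp: top_unique)
  next
    case 2
    from lp_sum_add_normalize[OF assms(1) 2] obtain s t :: real and u' v' :: "nat \<Rightarrow> ennreal"
      where st: "0 < s" "0 < t" "s + t = 1"
      and eq: "lp_sum r (\<lambda>n. u n + v n) = (lp_sum r u + lp_sum r v) *
      ennreal_powr (\<Sum>\<^sub>\<infinity>n\<in>{1..}. ennreal_powr (ennreal s * u' n + ennreal t * v' n) r) (1 / r)"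
      and one: "(\<Sum>\<^sub>\<infinity>n\<in>{1..}. ennreal s * ennreal_powr (u' n) r + ennreal t * ennreal_powr (v' n) r) = 1"
      by blast
    have "1 \<le> (\<Sum>\<^sub>\<infinity>n\<in>{1..}. ennreal_powr (ennreal s * u' n + ennreal t * v' n) r)"
      unfolding one[symmetric]
      by (intro infsum_ennreal_mono ennreal_powr_concave_combination) (use assms st in auto)
    from ennreal_powr_mono[OF this, of "1 / r"] show ?thesis
      unfolding eq using assms mult_left_mono[of 1 _ "lp_sum r u + lp_sum r v"] by simp
  qed
qed

lemma lp_sum_sum_le:
  assumes "r \<ge> 1" "finite F"
  shows "lp_sum r (\<lambda>n. \<Sum>m\<in>F. f m n) \<le> (\<Sum>m\<in>F. lp_sum r (f m))"
  using assms(2)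
proof induction
  case (insert m F)
  then show ?case
    using lp_sum_triangle[OF assms(1), of "f m" "\<lambda>n. \<Sum>m\<in>F. f m n"]
    by (simp add: order_trans[OF _ add_left_mono])
qed simp

lemma sum_lp_sum_le:
  assumes "0 < r" "r \<le> 1" "finite F"
  shows "(\<Sum>m\<in>F. lp_sum r (f m)) \<le> lp_sum r (\<lambda>n. \<Sum>m\<in>F. f m n)"
  using assms(3)
proof induction
  case (insert m F)
  then show ?case
    using lp_sum_reverse_triangle[OF assms(1,2), of "f m" "\<lambda>n. \<Sum>m\<in>F. f m n"]
    by (simp add: order_trans[OF add_left_mono])
qed simp

section \<open>Powers of monotonically weighted sums\<close>

lemma powr_increment_deriv:
  fixes h t p :: real
  assumes "0 < t" "0 \<le> h"
  shows "((\<lambda>t. (t + h) powr p - t powr p) has_real_derivative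
           p * ((t + h) powr (p - 1) - t powr (p - 1))) (at t)"
  using assms by (auto intro!: derivative_eq_intros simp: algebra_simps)

lemma powr_increment_continuous:
  fixes h p :: real
  assumes "0 < p" "0 \<le> h" "0 \<le> s"
  shows "continuous_on {s..t} (\<lambda>t. (t + h) powr p - t powr p)"
  using assms by (intro continuous_intros continuous_on_powr') auto

text \<open>Convexity in increment form: since \<open>p - 1 >= 0\<close>, the derivative with
  respect to the base point is non-negative.\<close>

lemma powr_increment_mono:
  fixes h p s t :: real
  assumes "1 \<le> p" "0 \<le> h" "0 \<le> s" "s \<le> t"
  shows "(s + h) powr p - s powr p \<le> (t + h) powr p - t powr p"
proof (rule DERIV_nonneg_imp_increasing_open[OF assms(4)])
  fix x assume "s < x" "x < t"
  then show "\<exists>y. ((\<lambda>t. (t + h) powr p - t powr p) has_real_derivative y) (at x) \<and> 0 \<le> y"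
    using assms powr_increment_deriv[of x h p]
    by (intro exI[of _ "p * ((x + h) powr (p - 1) - x powr (p - 1))"])
      (auto intro!: powr_mono2 mult_nonneg_nonneg)
qed (use assms in \<open>auto intro!: powr_increment_continuous\<close>)

text \<open>Concavity in increment form. For \<open>p < 1\<close> the derivative is singular at base
  point 0, so it is taken in the open interval only, with continuity up to the endpoints.\<close>

lemma powr_increment_antimono:
  fixes h p s t :: real
  assumes "0 < p" "p \<le> 1" "0 \<le> h" "0 \<le> s" "s \<le> t"
  shows "(t + h) powr p - t powr p \<le> (s + h) powr p - s powr p"
proof (rule DERIV_nonpos_imp_decreasing_open[OF assms(5)])
  fix x assume "s < x" "x < t"
  then show "\<exists>y. ((\<lambda>t. (t + h) powr p - t powr p) has_real_derivative y) (at x) \<and> y \<le> 0"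
    using assms powr_increment_deriv[of x h p]
    by (intro exI[of _ "p * ((x + h) powr (p - 1) - x powr (p - 1))"])
      (auto intro!: powr_mono2' mult_nonneg_nonpos)
qed (use assms in \<open>auto intro!: powr_increment_continuous\<close>)

text \<open>
  Since \<open>\<alpha>\<close> is increasing, the weighted tail beyond \<open>m\<close> is at least \<open>\<alpha> m\<close> times the plain one, so
  the increments of the power function at these two points compare, and they telescope.
\<close>

lemma powr_weighted_sum:
  fixes \<alpha> y :: "nat \<Rightarrow> real" and M :: nat and p :: real
  defines "Y \<equiv> \<lambda>m. \<Sum>k=m..M. y k"
  assumes nonneg: "\<And>k. k \<ge> 1 \<Longrightarrow> 0 \<le> \<alpha> k" "\<And>k. k \<ge> 1 \<Longrightarrow> 0 \<le> y k"
    and mono: "\<And>j k. 1 \<le> j \<Longrightarrow> j \<le> k \<Longrightarrow> \<alpha> j \<le> \<alpha> k"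
  shows powr_weighted_sum_ge: "1 \<le> p \<Longrightarrow>
      (\<Sum>m=1..M. \<alpha> m powr p * (Y m powr p - Y (Suc m) powr p)) \<le> (\<Sum>k=1..M. \<alpha> k * y k) powr p"
    and powr_weighted_sum_le: "0 < p \<Longrightarrow> p \<le> 1 \<Longrightarrow>
      (\<Sum>k=1..M. \<alpha> k * y k) powr p \<le> (\<Sum>m=1..M. \<alpha> m powr p * (Y m powr p - Y (Suc m) powr p))"
proof -
  define T where "T m = (\<Sum>k=m..M. \<alpha> k * y k)" for m
  have Y: "Y m = Y (Suc m) + y m" "T m = T (Suc m) + \<alpha> m * y m" if "m \<le> M" for m
    using that by (simp_all add: Y_def T_def sum.atLeast_Suc_atMost)
  have Y_nonneg: "0 \<le> Y m" if "m \<ge> 1" for m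
    unfolding Y_def using nonneg that by (intro sum_nonneg) auto
  have YT: "\<alpha> m * Y (Suc m) \<le> T (Suc m)" if "m \<ge> 1" for m
    unfolding Y_def T_def sum_distrib_left using that nonneg mono
    by (intro sum_mono mult_right_mono) auto
  \<comment> \<open>Absorbing the weight into the power gives an increment of length
    \<open>\<alpha> m * y m\<close> at base point \<open>\<alpha> m * Y (Suc m)\<close>. The
    telescoping sum has an increment of the same length at the larger base point
    \<open>T (Suc m)\<close>.\<close>
  have split: "\<alpha> m powr p * (Y m powr p - Y (Suc m) powr p)
      = (\<alpha> m * Y (Suc m) + \<alpha> m * y m) powr p - (\<alpha> m * Y (Suc m)) powr p" if "m \<in> {1..M}" for m
  proof -
    have "\<alpha> m * Y (Suc m) + \<alpha> m * y m = \<alpha> m * Y m"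
      using Y(1)[of m] that by (simp add: algebra_simps)
    then show ?thesis
      using that nonneg Y_nonneg[of m] Y_nonneg[of "Suc m"] by (simp add: powr_mult algebra_simps)
  qed
  have telescope: "(\<Sum>m=1..M. T m powr p - T (Suc m) powr p) = (\<Sum>k=1..M. \<alpha> k * y k) powr p"
  proof -
    have "(\<Sum>m=1..M. T m powr p - T (Suc m) powr p) = T 1 powr p - T (Suc M) powr p"
      \<comment> \<open>\<open>T\<close> is opaque here: the induction varies the summation bound
        but not the \<open>M\<close> inside \<open>T\<close>. Afterwards \<open>T (Suc M)\<close> is
        an empty sum, so its power is 0.\<close>
      by (induction M) auto
    then show ?thesis by (simp add: T_def)
  qed
  show "(\<Sum>m=1..M. \<alpha> m powr p * (Y m powr p - Y (Suc m) powr p)) \<le> (\<Sum>k=1..M. \<alpha> k * y k) powr p"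
    if "1 \<le> p"
    unfolding telescope[symmetric]
  proof (rule sum_mono)
    fix m assume m: "m \<in> {1..M}"
    show "\<alpha> m powr p * (Y m powr p - Y (Suc m) powr p) \<le> T m powr p - T (Suc m) powr p"
      unfolding split[OF m] using that m nonneg Y_nonneg[of "Suc m"] YT[of m] Y(2)[of m]
        powr_increment_mono[of p "\<alpha> m * y m" "\<alpha> m * Y (Suc m)" "T (Suc m)"] by simp
  qed
  show "(\<Sum>k=1..M. \<alpha> k * y k) powr p \<le> (\<Sum>m=1..M. \<alpha> m powr p * (Y m powr p - Y (Suc m) powr p))"
    if "0 < p" "p \<le> 1"
    unfolding telescope[symmetric]
  proof (rule sum_mono)
    fix m assume m: "m \<in> {1..M}"
    show "T m powr p - T (Suc m) powr p \<le> \<alpha> m powr p * (Y m powr p - Y (Suc m) powr p)"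
      unfolding split[OF m] using that m nonneg Y_nonneg[of "Suc m"] YT[of m] Y(2)[of m]
        powr_increment_antimono[of p "\<alpha> m * y m" "\<alpha> m * Y (Suc m)" "T (Suc m)"] by simp
  qed
qed

section \<open>Reduction to finitely supported sequences\<close>

definition truncated :: "nat \<Rightarrow> (nat \<Rightarrow> real) \<Rightarrow> nat \<Rightarrow> real" where
  "truncated M x k = (if k \<le> M then x k else 0)"

lemma truncated_unit_seq [simp]: "truncated m (unit_seq m) = unit_seq m"
  by (auto simp: truncated_def unit_seq_def fun_eq_iff)

lemma infsum_truncated:
  assumes "\<And>k. k \<ge> n \<Longrightarrow> 0 \<le> w k * x k"
  shows "(\<Sum>\<^sub>\<infinity>k\<in>{n..}. ennreal (w k * truncated M x k)) = ennreal (\<Sum>k=n..M. w k * x k)"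
proof -
  have "(\<Sum>\<^sub>\<infinity>k\<in>{n..}. ennreal (w k * truncated M x k))
      = (\<Sum>k\<in>{n..} \<inter> {..M}. ennreal (w k * truncated M x k))"
    by (intro infsum_eq_sum_superset) (auto simp: truncated_def)
  also have "\<dots> = (\<Sum>k=n..M. ennreal (w k * x k))"
    by (intro sum.cong) (auto simp: truncated_def)
  also have "\<dots> = ennreal (\<Sum>k=n..M. w k * x k)"
    using assms by (intro sum_ennreal) auto
  finally show ?thesis .
qed

lemma incseq_truncated:
  assumes "0 \<le> w" "0 \<le> x k"
  shows "incseq (\<lambda>M. ennreal (w * truncated M x k))"
  using assms by (auto simp: incseq_def truncated_def intro!: ennreal_leI mult_left_mono)

lemma incseq_infsum_truncated:
  assumes "\<And>k. k \<ge> n \<Longrightarrow> 0 \<le> w k" "\<And>k. k \<ge> n \<Longrightarrow> 0 \<le> x k"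
  shows "incseq (\<lambda>M. \<Sum>\<^sub>\<infinity>k\<in>{n..}. ennreal (w k * truncated M x k))"
  using incseq_truncated[OF assms] by (auto simp: incseq_def intro!: infsum_ennreal_mono)

text \<open>Each term is attained as soon as the truncation passes its index \<open>k\<close>;
  monotone convergence does the rest.\<close>

lemma infsum_eq_SUP_truncated:
  assumes "\<And>k. k \<ge> n \<Longrightarrow> 0 \<le> w k" "\<And>k. k \<ge> n \<Longrightarrow> 0 \<le> x k"
  shows "(\<Sum>\<^sub>\<infinity>k\<in>{n..}. ennreal (w k * x k))
           = (SUP M. \<Sum>\<^sub>\<infinity>k\<in>{n..}. ennreal (w k * truncated M x k))"
proof -
  have "ennreal (w k * x k) = (SUP M. ennreal (w k * truncated M x k))" if "k \<ge> n" for k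
  proof (rule antisym)
    show "ennreal (w k * x k) \<le> (SUP M. ennreal (w k * truncated M x k))"
      by (rule SUP_upper2[of k]) (auto simp: truncated_def)
    show "(SUP M. ennreal (w k * truncated M x k)) \<le> ennreal (w k * x k)"
      using assms[OF that] by (auto simp: truncated_def intro!: SUP_least)
  qed
  then have "(\<Sum>\<^sub>\<infinity>k\<in>{n..}. ennreal (w k * x k))
      = (\<Sum>\<^sub>\<infinity>k\<in>{n..}. SUP M. ennreal (w k * truncated M x k))"
    by (intro infsum_cong) simp
  also have "\<dots> = (SUP M. \<Sum>\<^sub>\<infinity>k\<in>{n..}. ennreal (w k * truncated M x k))"
    using assms by (intro infsum_ennreal_SUP incseq_truncated) auto
  finally show ?thesis .
qed

text \<open>Monotone convergence is used twice: for the inner sums over \<open>k\<close>, then for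
  the outer norm over \<open>n\<close>.\<close>

lemma tail_side_eq_SUP:
  assumes "p > 0" "\<And>n. n \<ge> 1 \<Longrightarrow> 0 \<le> b n" "\<And>k. k \<ge> 1 \<Longrightarrow> 0 \<le> c k" "\<And>k. k \<ge> 1 \<Longrightarrow> 0 \<le> x k"
  shows "tail_side p b c x = (SUP M. tail_side p b c (truncated M x))"
proof -
  have "tail_side p b c x
      = lp_sum p (\<lambda>n. SUP M. \<Sum>\<^sub>\<infinity>k\<in>{n..}. ennreal (b n * c k * truncated M x k))"
    unfolding tail_side_def using assms
    by (intro lp_sum_cong infsum_eq_SUP_truncated[of _ "\<lambda>k. b _ * c k"]) auto
  also have "\<dots> = (SUP M. tail_side p b c (truncated M x))"
    unfolding tail_side_def using assms
    by (intro lp_sum_SUP incseq_infsum_truncated[of _ "\<lambda>k. b _ * c k"]) auto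
  finally show ?thesis .
qed

lemma matrix_side_eq_SUP:
  assumes "q > 0" "\<And>n k. n \<ge> 1 \<Longrightarrow> k \<ge> 1 \<Longrightarrow> 0 \<le> a n k" "\<And>k. k \<ge> 1 \<Longrightarrow> 0 \<le> x k"
  shows "matrix_side q a x = (SUP M. matrix_side q a (truncated M x))"
proof -
  have "matrix_side q a x
      = lp_sum q (\<lambda>n. SUP M. \<Sum>\<^sub>\<infinity>k\<in>{1..}. ennreal (a n k * truncated M x k))"
    unfolding matrix_side_def using assms
    by (intro lp_sum_cong infsum_eq_SUP_truncated) auto
  also have "\<dots> = (SUP M. matrix_side q a (truncated M x))"
    unfolding matrix_side_def using assms
    by (intro lp_sum_SUP incseq_infsum_truncated) auto
  finally show ?thesis .
qed

section \<open>Summation by parts on both sides\<close>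

text \<open>
  With \<open>Y m\<close> the tail sum of \<open>c k * x k\<close>, summation by parts turns the \<open>p\<close>-th power of the tail side
  into a combination of its values at the unit sequences, with weight
  \<open>(Y m powr p - Y (m + 1) powr p) / c m powr p\<close> at \<open>m\<close>.
\<close>

definition parts_weight ::
    "real \<Rightarrow> (nat \<Rightarrow> real) \<Rightarrow> (nat \<Rightarrow> real) \<Rightarrow> nat \<Rightarrow> nat \<Rightarrow> real" where
  "parts_weight p c x M m =
     ((\<Sum>k=m..M. c k * x k) powr p - (\<Sum>k=Suc m..M. c k * x k) powr p) / c m powr p"

text \<open>Tail sums of a non-negative sequence decrease in \<open>m\<close>. This sign ensures
  that \<open>ennreal\<close> does not truncate the weights.\<close>

lemma parts_weight_nonneg:
  assumes "p > 0" "\<And>k. k \<ge> 1 \<Longrightarrow> 0 \<le> c k" "\<And>k. k \<ge> 1 \<Longrightarrow> 0 \<le> x k" "m \<ge> 1"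
  shows "0 \<le> parts_weight p c x M m"
  unfolding parts_weight_def using assms
  by (auto intro!: divide_nonneg_nonneg powr_mono2 sum_nonneg sum_mono2)

lemma tail_side_truncated:
  assumes "p > 0" "\<And>n. n \<ge> 1 \<Longrightarrow> 0 \<le> b n" "\<And>k. k \<ge> 1 \<Longrightarrow> 0 \<le> c k" "\<And>k. k \<ge> 1 \<Longrightarrow> 0 \<le> x k"
  shows "ennreal_powr (tail_side p b c (truncated M x)) p
           = ennreal (\<Sum>n=1..M. b n powr p * (\<Sum>k=n..M. c k * x k) powr p)"
proof -
  define Y where "Y n = (\<Sum>k=n..M. c k * x k)" for n
  have Y_nonneg: "0 \<le> Y n" if "n \<ge> 1" for n
    unfolding Y_def using assms that by (intro sum_nonneg) auto
  have inner: "(\<Sum>\<^sub>\<infinity>k\<in>{n..}. ennreal (b n * c k * truncated M x k)) = ennreal (b n * Y n)"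
    if "n \<ge> 1" for n
    using infsum_truncated[of n "\<lambda>k. b n * c k" x M] assms that
    by (simp add: Y_def sum_distrib_left mult.assoc)
  have "ennreal_powr (tail_side p b c (truncated M x)) p
      = (\<Sum>\<^sub>\<infinity>n\<in>{1..}. ennreal (b n powr p * Y n powr p))"
    unfolding tail_side_def using assms Y_nonneg
    by (subst lp_sum_powr) (auto simp: inner ennreal_powr_ennreal powr_mult intro!: infsum_cong)
  \<comment> \<open>Rows beyond \<open>M\<close> have an empty tail and contribute 0.\<close>
  also have "\<dots> = (\<Sum>n\<in>{1..} \<inter> {..M}. ennreal (b n powr p * Y n powr p))"
    by (intro infsum_eq_sum_superset) (auto simp: Y_def)
  also have "{1..} \<inter> {..M} = {1..M}"
    by auto
  finally show ?thesis
    by (simp add: sum_ennreal Y_def)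
qed

text \<open>A unit sequence is its own truncation at \<open>m\<close>, and each row
  \<open>n <= m\<close> has the same tail sum \<open>c m\<close>.\<close>

lemma tail_side_unit_seq:
  assumes "p > 0" "\<And>n. n \<ge> 1 \<Longrightarrow> 0 \<le> b n" "\<And>k. k \<ge> 1 \<Longrightarrow> 0 \<le> c k"
  shows "ennreal_powr (tail_side p b c (unit_seq m)) p
           = ennreal (\<Sum>n=1..m. b n powr p * c m powr p)"
proof -
  have "(\<Sum>k=n..m. c k * unit_seq m k) = c m" if "n \<le> m" for n
    using that by (simp add: unit_seq_def if_distrib cong: if_cong)
  then show ?thesis
    using tail_side_truncated[of p b c "unit_seq m" m] assms
    by (simp add: unit_seq_def)
qed

lemma tail_side_by_parts:
  assumes "p > 0" "\<And>n. n \<ge> 1 \<Longrightarrow> 0 \<le> b n" "\<And>k. k \<ge> 1 \<Longrightarrow> 0 < c k" "\<And>k. k \<ge> 1 \<Longrightarrow> 0 \<le> x k"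
  shows "ennreal_powr (tail_side p b c (truncated M x)) p
           = (\<Sum>m=1..M. ennreal (parts_weight p c x M m) *
               ennreal_powr (tail_side p b c (unit_seq m)) p)"
proof -
  have c: "\<And>k. k \<ge> 1 \<Longrightarrow> 0 \<le> c k"
    using assms(3) less_imp_le by blast
  define Z where "Z n = (\<Sum>k=n..M. c k * x k) powr p" for n
  \<comment> \<open>The sum telescopes; the boundary term \<open>Z (Suc M)\<close> is the power of
    an empty sum, hence 0.\<close>
  have Z: "Z n = (\<Sum>m=n..M. Z m - Z (Suc m))" if "n \<le> M" for n
    using sum_Suc_diff[of n "Suc M" "\<lambda>m. - Z m"] that by (simp add: Z_def)
  have "(\<Sum>n=1..M. b n powr p * Z n)
      = (\<Sum>n=1..M. \<Sum>m | m \<in> {1..M} \<and> n \<le> m. b n powr p * (Z m - Z (Suc m)))"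
  proof (rule sum.cong[OF refl])
    fix n assume "n \<in> {1..M}"
    then have "{m \<in> {1..M}. n \<le> m} = {n..M}" by auto
    then show "b n powr p * Z n = (\<Sum>m | m \<in> {1..M} \<and> n \<le> m. b n powr p * (Z m - Z (Suc m)))"
      using Z[of n] \<open>n \<in> {1..M}\<close> by (simp add: sum_distrib_left)
  qed
  also have "\<dots> = (\<Sum>m=1..M. \<Sum>n | n \<in> {1..M} \<and> n \<le> m. b n powr p * (Z m - Z (Suc m)))"
    by (rule sum.swap_restrict) auto
  \<comment> \<open>The factor \<open>c m powr p\<close> cancels the denominator of the weight,
    which is non-zero because \<open>c m > 0\<close>.\<close>
  also have "\<dots> = (\<Sum>m=1..M. parts_weight p c x M m * (\<Sum>n=1..m. b n powr p * c m powr p))"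
  proof (rule sum.cong[OF refl])
    fix m assume m: "m \<in> {1..M}"
    then have "{n \<in> {1..M}. n \<le> m} = {1..m}" by auto
    moreover have "c m > 0" using assms(3) m by simp
    ultimately show "(\<Sum>n | n \<in> {1..M} \<and> n \<le> m. b n powr p * (Z m - Z (Suc m)))
        = parts_weight p c x M m * (\<Sum>n=1..m. b n powr p * c m powr p)"
      by (simp add: parts_weight_def Z_def flip: sum_distrib_right)
  qed
  finally have "ennreal_powr (tail_side p b c (truncated M x)) p
      = ennreal (\<Sum>m=1..M. parts_weight p c x M m * (\<Sum>n=1..m. b n powr p * c m powr p))"
    using tail_side_truncated[OF assms(1,2) c assms(4)] by (simp add: Z_def)
  also have "\<dots> = (\<Sum>m=1..M. ennreal (parts_weight p c x M m) *
      ennreal (\<Sum>n=1..m. b n powr p * c m powr p))"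
    using parts_weight_nonneg[where c = c and x = x, OF assms(1) c assms(4)]
    by (subst sum_ennreal[symmetric]) (auto simp: sum_nonneg ennreal_mult simp del: sum_ennreal)
  finally show ?thesis
    using tail_side_unit_seq[OF assms(1,2) c] by simp
qed

lemma matrix_side_truncated:
  assumes "p > 0" "\<And>n k. n \<ge> 1 \<Longrightarrow> k \<ge> 1 \<Longrightarrow> 0 \<le> a n k" "\<And>k. k \<ge> 1 \<Longrightarrow> 0 \<le> x k"
  shows "ennreal_powr (matrix_side q a (truncated M x)) p
           = lp_sum (q / p) (\<lambda>n. ennreal ((\<Sum>k=1..M. a n k * x k) powr p))"
  unfolding matrix_side_def using assms
  by (subst lp_sum_of_powr)
    (auto simp: infsum_truncated intro!: lp_sum_cong ennreal_powr_ennreal sum_nonneg)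

lemma matrix_side_unit_seq:
  assumes "p > 0" "\<And>n k. n \<ge> 1 \<Longrightarrow> k \<ge> 1 \<Longrightarrow> 0 \<le> a n k" "m \<ge> 1"
  shows "ennreal_powr (matrix_side q a (unit_seq m)) p = lp_sum (q / p) (\<lambda>n. ennreal (a n m powr p))"
proof -
  have "(\<Sum>k=1..m. a n k * unit_seq m k) = a n m" for n
    using assms(3) by (simp add: unit_seq_def if_distrib cong: if_cong)
  then show ?thesis
    using matrix_side_truncated[of p a "unit_seq m" q m] assms by (simp add: unit_seq_def)
qed

text \<open>Homogeneity moves each weight into its norm, and Minkowski with exponent
  \<open>q / p\<close> merges the norms. Each row is then an instance of
  \<open>powr_weighted_sum\<close> with the increasing ratios \<open>a n k / c k\<close> as
  \<open>\<alpha>\<close> and \<open>c k * x k\<close> as \<open>y\<close>.\<close>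

lemma matrix_side_by_parts:
  fixes a :: "nat \<Rightarrow> nat \<Rightarrow> real"
  assumes a: "\<And>n k. n \<ge> 1 \<Longrightarrow> k \<ge> 1 \<Longrightarrow> 0 \<le> a n k" and c: "\<And>k. k \<ge> 1 \<Longrightarrow> 0 < c k"
    and x: "\<And>k. k \<ge> 1 \<Longrightarrow> 0 \<le> x k"
    and mono: "\<And>n. n \<ge> 1 \<Longrightarrow> mono_on {1..} (\<lambda>k. a n k / c k)"
  shows matrix_side_by_parts_ge: "1 \<le> p \<Longrightarrow> 0 < q \<Longrightarrow> q \<le> p \<Longrightarrow>
      (\<Sum>m=1..M. ennreal (parts_weight p c x M m) * ennreal_powr (matrix_side q a (unit_seq m)) p)
        \<le> ennreal_powr (matrix_side q a (truncated M x)) p"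
    and matrix_side_by_parts_le: "0 < p \<Longrightarrow> p \<le> 1 \<Longrightarrow> p \<le> q \<Longrightarrow>
      ennreal_powr (matrix_side q a (truncated M x)) p
        \<le> (\<Sum>m=1..M. ennreal (parts_weight p c x M m) * ennreal_powr (matrix_side q a (unit_seq m)) p)"
proof -
  define d where "d = parts_weight p c x M"
  define \<alpha> where "\<alpha> n k = a n k / c k" for n k
  define Y where "Y m = (\<Sum>k=m..M. c k * x k)" for m
  have c': "\<And>k. k \<ge> 1 \<Longrightarrow> 0 \<le> c k"
    using c less_imp_le by blast
  have d: "0 \<le> d m" if "0 < p" "m \<ge> 1" for m
    unfolding d_def using parts_weight_nonneg[OF that(1) c' x that(2)] .
  have lhs: "(\<Sum>m=1..M. ennreal (d m) * ennreal_powr (matrix_side q a (unit_seq m)) p)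
      = (\<Sum>m=1..M. lp_sum (q / p) (\<lambda>n. ennreal (d m * a n m powr p)))" if "0 < p" "0 < q"
    using that d by (intro sum.cong)
      (simp_all add: matrix_side_unit_seq[OF _ a] ennreal_mult flip: lp_sum_cmult)
  \<comment> \<open>The denominator \<open>c m powr p\<close> of the weight turns
    \<open>a n m powr p\<close> into the power of the ratio.\<close>
  have weights: "(\<Sum>m=1..M. d m * a n m powr p)
      = (\<Sum>m=1..M. \<alpha> n m powr p * (Y m powr p - Y (Suc m) powr p))" if "n \<ge> 1" for n
    using that a c c' by (intro sum.cong) (auto simp: d_def \<alpha>_def Y_def parts_weight_def powr_divide)
  have row: "(\<Sum>k=1..M. a n k * x k) = (\<Sum>k=1..M. \<alpha> n k * (c k * x k))" for n
    by (intro sum.cong) (use c in \<open>force simp: \<alpha>_def\<close>)+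
  have \<alpha>: "0 \<le> \<alpha> n k" "1 \<le> j \<Longrightarrow> j \<le> k \<Longrightarrow> \<alpha> n j \<le> \<alpha> n k" if "n \<ge> 1" "k \<ge> 1" for n j k
    using that a c' mono_onD[OF mono] by (auto simp: \<alpha>_def)
  have y: "0 \<le> c k * x k" if "k \<ge> 1" for k
    using that c' x by simp
  show "(\<Sum>m=1..M. ennreal (parts_weight p c x M m) * ennreal_powr (matrix_side q a (unit_seq m)) p)
        \<le> ennreal_powr (matrix_side q a (truncated M x)) p" if "1 \<le> p" "0 < q" "q \<le> p"
  proof -
    have "(\<Sum>m=1..M. ennreal (d m) * ennreal_powr (matrix_side q a (unit_seq m)) p)
        \<le> lp_sum (q / p) (\<lambda>n. \<Sum>m=1..M. ennreal (d m * a n m powr p))"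
      using that lhs by (auto intro!: sum_lp_sum_le)
    also have "\<dots> \<le> lp_sum (q / p) (\<lambda>n. ennreal ((\<Sum>k=1..M. a n k * x k) powr p))"
    proof (intro lp_sum_mono)
      fix n :: nat assume n: "n \<ge> 1"
      have "(\<Sum>m=1..M. d m * a n m powr p) \<le> (\<Sum>k=1..M. a n k * x k) powr p"
        unfolding weights[OF n] row Y_def
        using powr_weighted_sum_ge[of "\<alpha> n" "\<lambda>k. c k * x k" p M] \<alpha> y n that by simp
      then show "(\<Sum>m=1..M. ennreal (d m * a n m powr p)) \<le> ennreal ((\<Sum>k=1..M. a n k * x k) powr p)"
        using d that by (subst sum_ennreal) (auto simp: ennreal_leI)
    qed (use that in simp)
    also have "\<dots> = ennreal_powr (matrix_side q a (truncated M x)) p"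
      using that by (subst matrix_side_truncated[OF _ a x]) auto
    finally show ?thesis by (simp add: d_def)
  qed
  show "ennreal_powr (matrix_side q a (truncated M x)) p
        \<le> (\<Sum>m=1..M. ennreal (parts_weight p c x M m) * ennreal_powr (matrix_side q a (unit_seq m)) p)"
    if "0 < p" "p \<le> 1" "p \<le> q"
  proof -
    have "ennreal_powr (matrix_side q a (truncated M x)) p
        = lp_sum (q / p) (\<lambda>n. ennreal ((\<Sum>k=1..M. a n k * x k) powr p))"
      using that by (subst matrix_side_truncated[OF _ a x]) auto
    also have "\<dots> \<le> lp_sum (q / p) (\<lambda>n. \<Sum>m=1..M. ennreal (d m * a n m powr p))"
    proof (intro lp_sum_mono)
      fix n :: nat assume n: "n \<ge> 1"
      have "(\<Sum>k=1..M. a n k * x k) powr p \<le> (\<Sum>m=1..M. d m * a n m powr p)"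
        unfolding weights[OF n] row Y_def
        using powr_weighted_sum_le[of "\<alpha> n" "\<lambda>k. c k * x k" p M] \<alpha> y n that by simp
      then show "ennreal ((\<Sum>k=1..M. a n k * x k) powr p) \<le> (\<Sum>m=1..M. ennreal (d m * a n m powr p))"
        using d that by (subst sum_ennreal) (auto simp: ennreal_leI)
    qed (use that in simp)
    also have "\<dots> \<le> (\<Sum>m=1..M. ennreal (d m) * ennreal_powr (matrix_side q a (unit_seq m)) p)"
      using that lhs by (auto intro!: lp_sum_sum_le)
    finally show ?thesis by (simp add: d_def)
  qed
qed

section \<open>From unit sequences to all non-negative sequences\<close>

theorem theorem1p1:
  fixes a :: "nat \<Rightarrow> nat \<Rightarrow> real" and b c :: "nat \<Rightarrow> real" and K p q :: real
  assumes a_nonneg: "\<And>n k. n \<ge> 1 \<Longrightarrow> k \<ge> 1 \<Longrightarrow> a n k \<ge> 0"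
    and b_nonneg: "\<And>n. n \<ge> 1 \<Longrightarrow> b n \<ge> 0"
    and c_pos: "\<And>k. k \<ge> 1 \<Longrightarrow> c k > 0"
    and ratio_mono: "\<And>n. n \<ge> 1 \<Longrightarrow> mono_on {1..} (\<lambda>k. a n k / c k)"
    and K_pos: "K > 0"
  shows "(p \<ge> 1 \<and> 0 < q \<and> q \<le> p \<longrightarrow>
           ((\<forall>x::nat \<Rightarrow> real. (\<forall>k\<ge>1. x k \<ge> 0) \<longrightarrow> tail_side p b c x \<le> ennreal K * matrix_side q a x)
            \<longleftrightarrow> (\<forall>m\<ge>1. tail_side p b c (unit_seq m) \<le> ennreal K * matrix_side q a (unit_seq m))))
       \<and> (0 < p \<and> p \<le> 1 \<and> q \<ge> p \<longrightarrow>
           ((\<forall>x::nat \<Rightarrow> real. (\<forall>k\<ge>1. x k \<ge> 0) \<longrightarrow> tail_side p b c x \<ge> ennreal K * matrix_side q a x)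
            \<longleftrightarrow> (\<forall>m\<ge>1. tail_side p b c (unit_seq m) \<ge> ennreal K * matrix_side q a (unit_seq m))))"
proof (intro conjI impI iffI allI)
  fix m :: nat
  assume "\<forall>x. (\<forall>k\<ge>1. x k \<ge> 0) \<longrightarrow> tail_side p b c x \<le> ennreal K * matrix_side q a x"
  then show "tail_side p b c (unit_seq m) \<le> ennreal K * matrix_side q a (unit_seq m)"
    by (simp add: unit_seq_def)
next
  fix m :: nat
  assume "\<forall>x. (\<forall>k\<ge>1. x k \<ge> 0) \<longrightarrow> tail_side p b c x \<ge> ennreal K * matrix_side q a x"
  then show "tail_side p b c (unit_seq m) \<ge> ennreal K * matrix_side q a (unit_seq m)"
    by (simp add: unit_seq_def)
next
  fix x :: "nat \<Rightarrow> real"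
  assume pq: "1 \<le> p \<and> 0 < q \<and> q \<le> p"
    and unit: "\<forall>m\<ge>1. tail_side p b c (unit_seq m) \<le> ennreal K * matrix_side q a (unit_seq m)"
    and x: "\<forall>k\<ge>1. 0 \<le> x k"
  \<comment> \<open>The comparison is made between \<open>p\<close>-th powers, where the tail side
    is exactly a weighted sum over unit sequences. \<open>K\<close> factors out as
    \<open>K powr p\<close>, and the power is finally removed by strict monotonicity.\<close>
  have finite: "tail_side p b c (truncated M x) \<le> ennreal K * matrix_side q a (truncated M x)" for M
  proof -
    have "ennreal_powr (tail_side p b c (truncated M x)) p
        = (\<Sum>m=1..M. ennreal (parts_weight p c x M m) * ennreal_powr (tail_side p b c (unit_seq m)) p)"
      using pq x b_nonneg c_pos by (intro tail_side_by_parts) auto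
    also have "\<dots> \<le> (\<Sum>m=1..M. ennreal (parts_weight p c x M m) *
        ennreal_powr (ennreal K * matrix_side q a (unit_seq m)) p)"
      using pq unit by (intro sum_mono mult_left_mono ennreal_powr_mono) auto
    also have "\<dots> = ennreal_powr (ennreal K) p *
        (\<Sum>m=1..M. ennreal (parts_weight p c x M m) * ennreal_powr (matrix_side q a (unit_seq m)) p)"
      by (simp add: ennreal_powr_mult sum_distrib_left mult_ac)
    also have "\<dots> \<le> ennreal_powr (ennreal K) p * ennreal_powr (matrix_side q a (truncated M x)) p"
      using pq x a_nonneg c_pos ratio_mono by (intro mult_left_mono matrix_side_by_parts_ge) auto
    finally show ?thesis
      using pq by (simp add: ennreal_powr_le_iff flip: ennreal_powr_mult)
  qed
  \<comment> \<open>Both sides are suprema over truncations, so the inequality passes to the limit,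
    including infinite values.\<close>
  have "tail_side p b c x = (SUP M. tail_side p b c (truncated M x))"
    using pq x b_nonneg c_pos by (intro tail_side_eq_SUP) (auto simp: less_imp_le)
  also have "\<dots> \<le> (SUP M. ennreal K * matrix_side q a (truncated M x))"
    by (intro SUP_mono') (rule finite)
  also have "\<dots> = ennreal K * matrix_side q a x"
    using pq x a_nonneg by (subst matrix_side_eq_SUP[of q a x]) (auto simp: SUP_mult_left_ennreal)
  finally show "tail_side p b c x \<le> ennreal K * matrix_side q a x" .
next
  fix x :: "nat \<Rightarrow> real"
  assume pq: "0 < p \<and> p \<le> 1 \<and> p \<le> q"
    and unit: "\<forall>m\<ge>1. ennreal K * matrix_side q a (unit_seq m) \<le> tail_side p b c (unit_seq m)"
    and x: "\<forall>k\<ge>1. 0 \<le> x k"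
  \<comment> \<open>The same chain runs in the opposite direction, starting from the matrix
    side.\<close>
  have finite: "ennreal K * matrix_side q a (truncated M x) \<le> tail_side p b c (truncated M x)" for M
  proof -
    have "ennreal_powr (ennreal K) p * ennreal_powr (matrix_side q a (truncated M x)) p
        \<le> ennreal_powr (ennreal K) p *
          (\<Sum>m=1..M. ennreal (parts_weight p c x M m) * ennreal_powr (matrix_side q a (unit_seq m)) p)"
      using pq x a_nonneg c_pos ratio_mono by (intro mult_left_mono matrix_side_by_parts_le) auto
    also have "\<dots> = (\<Sum>m=1..M. ennreal (parts_weight p c x M m) *
        ennreal_powr (ennreal K * matrix_side q a (unit_seq m)) p)"
      by (simp add: ennreal_powr_mult sum_distrib_left mult_ac)
    also have "\<dots> \<le> (\<Sum>m=1..M. ennreal (parts_weight p c x M m) *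
        ennreal_powr (tail_side p b c (unit_seq m)) p)"
      using pq unit by (intro sum_mono mult_left_mono ennreal_powr_mono) auto
    also have "\<dots> = ennreal_powr (tail_side p b c (truncated M x)) p"
      using pq x b_nonneg c_pos by (intro tail_side_by_parts[symmetric]) auto
    finally show ?thesis
      using pq by (simp add: ennreal_powr_le_iff flip: ennreal_powr_mult)
  qed
  have "ennreal K * matrix_side q a x = (SUP M. ennreal K * matrix_side q a (truncated M x))"
    using pq x a_nonneg by (subst matrix_side_eq_SUP[of q a x]) (auto simp: SUP_mult_left_ennreal)
  also have "\<dots> \<le> (SUP M. tail_side p b c (truncated M x))"
    by (intro SUP_mono') (rule finite)
  also have "\<dots> = tail_side p b c x"
    using pq x b_nonneg c_pos by (intro tail_side_eq_SUP[symmetric]) (auto simp: less_imp_le)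
  finally show "ennreal K * matrix_side q a x \<le> tail_side p b c x" .
qed

end
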